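(* Let ${}^*\mathbb{C}$ and ${}^*\mathbb{R}$ be the non-standard complex and real numbers constructed (see context) from the ultrafilter $\mathcal{U}$ on $\mathcal{D}(\mathbb{R}^d)$. Then: (i) Every $\gamma\in{}^*\mathbb{C}$ can be uniquely represented in the form $\gamma=\alpha+\beta i$ with $\alpha,\beta\in{}^*\mathbb{R}$, where $\alpha=\Re\gamma$, $\beta=\Im\gamma$, and $|\gamma|=\sqrt{\alpha^2+\beta^2}$. (ii) ${}^*\mathbb{C}$ is an algebraically closed non-Archimedean field of characteristic zero, and $\mathbb{C}$ is a subfield of ${}^*\mathbb{C}$. (iii) ${}^*\mathbb{R}$ is a totally ordered non-Archimedean real closed field. Moreover, for $\alpha\in{}^*\mathbb{R}$, $\alpha>0$ if and only if $\alpha=\beta^2$ for some $\beta\in{}^*\mathbb{R}$, $\beta\neq0$. $\mathbb{R}$ is an ordered subfield of ${}^*\mathbb{R}$.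
   Context: Let $d\ge 1$ and $\mathcal{D}(\mathbb{R}^d)=\mathcal{C}_0^\infty(\mathbb{R}^d)$ (smooth complex-valued functions with compact support). Put $\mathcal{B}_0=\mathcal{D}(\mathbb{R}^d)$ and, for $n\in\mathbb{N}=\{1,2,\dots\}$, let $\mathcal{B}_n$ be the set of all $\varphi\in\mathcal{D}(\mathbb{R}^d)$ such that: $\varphi$ is real-valued and symmetric ($\varphi(-x)=\varphi(x)$); $\varphi(x)=0$ whenever $\|x\|\ge 1/n$; $\int\varphi=1$; $\int x^\alpha\varphi(x)\,dx=0$ for all multi-indices $\alpha\in\mathbb{N}_0^d$ with $1\le|\alpha|\le n$; and $1\le\int|\varphi|<1+\frac1n$. It is known that each $\mathcal{B}_n$ is non-empty, that $\mathcal{B}_0\supset\mathcal{B}_1\supset\mathcal{B}_2\supset\cdots$, and that $\bigcap_n\mathcal{B}_n=\varnothing$. Fix an ultrafilter $\mathcal{U}$ on the set $\mathcal{D}(\mathbb{R}^d)$ containing the filter $\{\Phi\subseteq\mathcal{D}(\mathbb{R}^d): \mathcal{B}_n\subseteq\Phi\text{ for some }n\in\mathbb{N}\}$. ${}^*\mathbb{C}$ is the quotient of the ring $\mathbb{C}^{\mathcal{D}(\mathbb{R}^d)}$ of all families $(A_\varphi)_{\varphi\in\mathcal{D}(\mathbb{R}^d)}$ of complex numbers (pointwise operations) by the relation $(A_\varphi)\sim(B_\varphi)$ iff $\{\varphi: A_\varphi=B_\varphi\}\in\mathcal{U}$; the class of $(A_\varphi)$ is $\langle A_\varphi\rangle$.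 Ring operations, absolute value, real part $\Re$, imaginary part $\Im$ and conjugation are defined pointwise on representatives. $\mathbb{C}$ is embedded in ${}^*\mathbb{C}$ by constant families. ${}^*\mathbb{R}=\{\langle A_\varphi\rangle: \{\varphi: A_\varphi\in\mathbb{R}\}\in\mathcal{U}\}$, with order relation determined by $\langle A_\varphi\rangle>0$ iff $\{\varphi: A_\varphi>0\}\in\mathcal{U}$. "Non-Archimedean" means that the field contains non-zero infinitesimals, i.e. elements $h$ with $0<|h|<1/n$ for all $n\in\mathbb{N}$. *)

theory Defs
  imports "HOL-Analysis.Analysis" "HOL-Algebra.Algebraic_Closure_Type"
begin

section \<open>Test functions on \<open>\<real>\<^sup>d\<close>\<close>

text \<open>The dimension \<open>d\<close> is \<open>CARD('n)\<close> for a finite index type \<open>'n\<close>.\<close>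

primrec times_cont_diff :: "nat \<Rightarrow> (real^'n \<Rightarrow> complex) \<Rightarrow> bool" where
  "times_cont_diff 0 f \<longleftrightarrow> continuous_on UNIV f"
| "times_cont_diff (Suc k) f \<longleftrightarrow>
     (\<forall>x. f differentiable (at x)) \<and>
     (\<forall>v. times_cont_diff k (\<lambda>x. frechet_derivative f (at x) v))"

definition smooth :: "(real^'n \<Rightarrow> complex) \<Rightarrow> bool" where
  "smooth f \<longleftrightarrow> (\<forall>k. times_cont_diff k f)"

lemma smooth_zero: "smooth (\<lambda>_::real^('n::finite). 0)"
proof -
  have "times_cont_diff k (\<lambda>_::real^'n. 0)" for k
    by (induction k) simp_all
  then show ?thesis
    by (simp add: smooth_def)
qed

typedef (overloaded) 'n test_fun =
  "{f :: real^'n::finite \<Rightarrow> complex. smooth f \<and> compact (closure {x. f x \<noteq> 0})}"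
  morphisms apply_test Abs_test
  by (rule exI[of _ "\<lambda>_. 0"]) (simp add: smooth_zero)

definition basic_set :: "nat \<Rightarrow> ('n::finite) test_fun set" where
  "basic_set n = (if n = 0 then UNIV else {\<phi>.
     (\<forall>x. apply_test \<phi> x \<in> \<real>) \<and>
     (\<forall>x. apply_test \<phi> (- x) = apply_test \<phi> x) \<and>
     (\<forall>x. norm x \<ge> 1 / real n \<longrightarrow> apply_test \<phi> x = 0) \<and>
     (LINT x|lborel. apply_test \<phi> x) = 1 \<and>
     (\<forall>\<alpha> :: 'n \<Rightarrow> nat. 1 \<le> (\<Sum>i\<in>UNIV. \<alpha> i) \<and> (\<Sum>i\<in>UNIV. \<alpha> i) \<le> n \<longrightarrow>
        (LINT x|lborel. complex_of_real (\<Prod>i\<in>UNIV. (x $ i) ^ \<alpha> i) * apply_test \<phi> x) = 0) \<and>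
     1 \<le> (LINT x|lborel. cmod (apply_test \<phi> x)) \<and>
     (LINT x|lborel. cmod (apply_test \<phi> x)) < 1 + 1 / real n})"

text \<open>An ultrafilter on the type \<open>'a\<close>; \<open>\<Phi> \<in> \<U>\<close> is written \<open>\<forall>\<^sub>F \<phi> in \<U>. \<phi> \<in> \<Phi>\<close>.\<close>

definition ultrafilter :: "'a filter \<Rightarrow> bool" where
  "ultrafilter \<U> \<longleftrightarrow> \<U> \<noteq> bot \<and>
     (\<forall>P. eventually P \<U> \<or> eventually (\<lambda>x. \<not> P x) \<U>)"

definition contains_basic_filter :: "('n::finite) test_fun filter \<Rightarrow> bool" where
  "contains_basic_filter \<U> \<longleftrightarrow>
     (\<forall>\<Phi>. (\<exists>n\<ge>1. basic_set n \<subseteq> \<Phi>) \<longrightarrow> (\<forall>\<^sub>F \<phi> in \<U>. \<phi> \<in> \<Phi>))"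


section \<open>The non-standard complex and real numbers\<close>

type_synonym 'n family = "'n test_fun \<Rightarrow> complex"

definition star_rel :: "('n::finite) test_fun filter \<Rightarrow> ('n family \<times> 'n family) set" where
  "star_rel \<U> = {(A, B). \<forall>\<^sub>F \<phi> in \<U>. A \<phi> = B \<phi>}"

definition star_class :: "('n::finite) test_fun filter \<Rightarrow> 'n family \<Rightarrow> 'n family set" where
  "star_class \<U> A = star_rel \<U> `` {A}"

text \<open>
  Pointwise operations on representatives. The unions range over all choices of
  representatives; as the operations respect \<^const>\<open>star_rel\<close>, all of these give the same class.
\<close>

definition star_map :: "('n::finite) test_fun filter \<Rightarrow> (complex \<Rightarrow> complex) \<Rightarrow>
    'n family set \<Rightarrow> 'n family set" where
  "star_map \<U> f x = (\<Union>A\<in>x. star_class \<U> (\<lambda>\<phi>. f (A \<phi>)))"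

definition star_map2 :: "('n::finite) test_fun filter \<Rightarrow> (complex \<Rightarrow> complex \<Rightarrow> complex) \<Rightarrow>
    'n family set \<Rightarrow> 'n family set \<Rightarrow> 'n family set" where
  "star_map2 \<U> f x y = (\<Union>A\<in>x. \<Union>B\<in>y. star_class \<U> (\<lambda>\<phi>. f (A \<phi>) (B \<phi>)))"

definition star_embed :: "('n::finite) test_fun filter \<Rightarrow> complex \<Rightarrow> 'n family set" where
  "star_embed \<U> z = star_class \<U> (\<lambda>_. z)"

definition star_complex :: "('n::finite) test_fun filter \<Rightarrow> 'n family set ring" where
  "star_complex \<U> = \<lparr>
     carrier = UNIV // star_rel \<U>,
     monoid.mult = star_map2 \<U> (*),
     one = star_embed \<U> 1,
     ring.zero = star_embed \<U> 0,
     add = star_map2 \<U> (+)\<rparr>"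

definition star_real :: "('n::finite) test_fun filter \<Rightarrow> 'n family set ring" where
  "star_real \<U> = (star_complex \<U>)
     \<lparr>carrier := {star_class \<U> A | A. \<forall>\<^sub>F \<phi> in \<U>. A \<phi> \<in> \<real>}\<rparr>"

definition star_Re :: "('n::finite) test_fun filter \<Rightarrow> 'n family set \<Rightarrow> 'n family set" where
  "star_Re \<U> = star_map \<U> (\<lambda>z. complex_of_real (Re z))"

definition star_Im :: "('n::finite) test_fun filter \<Rightarrow> 'n family set \<Rightarrow> 'n family set" where
  "star_Im \<U> = star_map \<U> (\<lambda>z. complex_of_real (Im z))"

definition star_abs :: "('n::finite) test_fun filter \<Rightarrow> 'n family set \<Rightarrow> 'n family set" where
  "star_abs \<U> = star_map \<U> (\<lambda>z. complex_of_real (cmod z))"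

definition star_pos :: "('n::finite) test_fun filter \<Rightarrow> 'n family set \<Rightarrow> bool" where
  "star_pos \<U> x \<longleftrightarrow> (\<exists>A\<in>x. \<forall>\<^sub>F \<phi> in \<U>. A \<phi> \<in> \<real> \<and> 0 < Re (A \<phi>))"

definition star_less :: "('n::finite) test_fun filter \<Rightarrow> 'n family set \<Rightarrow> 'n family set \<Rightarrow> bool" where
  "star_less \<U> x y \<longleftrightarrow> star_pos \<U> (y \<ominus>\<^bsub>star_complex \<U>\<^esub> x)"

text \<open>The non-negative square root in the ordered field of non-standard reals.\<close>

definition star_sqrt :: "('n::finite) test_fun filter \<Rightarrow> 'n family set \<Rightarrow> 'n family set" where
  "star_sqrt \<U> x = (THE s. s \<in> carrier (star_real \<U>) \<and>
     (s = \<zero>\<^bsub>star_real \<U>\<^esub> \<or> star_less \<U> \<zero>\<^bsub>star_real \<U>\<^esub> s) \<and>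
     s [^]\<^bsub>star_real \<U>\<^esub> (2::nat) = x)"

definition non_archimedean :: "('n::finite) test_fun filter \<Rightarrow> 'n family set ring \<Rightarrow> bool" where
  "non_archimedean \<U> K \<longleftrightarrow> (\<exists>h\<in>carrier K.
     star_less \<U> (star_embed \<U> 0) (star_abs \<U> h) \<and>
     (\<forall>n::nat. n \<ge> 1 \<longrightarrow> star_less \<U> (star_abs \<U> h) (star_embed \<U> (1 / of_nat n))))"


section \<open>Field-theoretic notions\<close>

definition char_zero :: "('a, 'm) ring_scheme \<Rightarrow> bool" where
  "char_zero R \<longleftrightarrow> (\<forall>n::nat. n \<ge> 1 \<longrightarrow> [n] \<cdot>\<^bsub>R\<^esub> \<one>\<^bsub>R\<^esub> \<noteq> \<zero>\<^bsub>R\<^esub>)"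

locale totally_ordered_field = field R for R (structure) +
  fixes less :: "'a \<Rightarrow> 'a \<Rightarrow> bool"
  assumes less_irrefl: "x \<in> carrier R \<Longrightarrow> \<not> less x x"
    and less_trans: "\<lbrakk>x \<in> carrier R; y \<in> carrier R; z \<in> carrier R; less x y; less y z\<rbrakk> \<Longrightarrow> less x z"
    and less_total: "\<lbrakk>x \<in> carrier R; y \<in> carrier R\<rbrakk> \<Longrightarrow> less x y \<or> x = y \<or> less y x"
    and less_add: "\<lbrakk>x \<in> carrier R; y \<in> carrier R; z \<in> carrier R; less x y\<rbrakk> \<Longrightarrow> less (x \<oplus> z) (y \<oplus> z)"
    and less_mult: "\<lbrakk>x \<in> carrier R; y \<in> carrier R; less \<zero> x; less \<zero> y\<rbrakk> \<Longrightarrow> less \<zero> (x \<otimes> y)"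

text \<open>A field is (formally) real if \<open>- 1\<close> is not a sum of squares.\<close>

definition formally_real :: "('a, 'm) ring_scheme \<Rightarrow> bool" where
  "formally_real R \<longleftrightarrow> field R \<and>
     (\<forall>(n::nat) f. f \<in> {..<n} \<rightarrow> carrier R \<longrightarrow>
        (\<Oplus>\<^bsub>R\<^esub>i\<in>{..<n}. f i \<otimes>\<^bsub>R\<^esub> f i) \<noteq> \<ominus>\<^bsub>R\<^esub> \<one>\<^bsub>R\<^esub>)"

text \<open>
  Real closed in the sense of Artin and Schreier: formally real, without a proper
  algebraic extension that is formally real. HOL cannot quantify over types inside a
  formula, so the type of the elements of the extension fields is a parameter; a
  statement in which this type is a variable is about extensions on every type.
\<close>

definition real_closed_field :: "'b itself \<Rightarrow> ('a, 'm) ring_scheme \<Rightarrow> bool" where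
  "real_closed_field _ F \<longleftrightarrow> formally_real F \<and>
     (\<forall>(L :: 'b ring) h.
        formally_real L \<and> h \<in> ring_hom F L \<and>
        (\<forall>x\<in>carrier L. (ring.algebraic L over (h ` carrier F)) x) \<longrightarrow> h ` carrier F = carrier L)"

end

theory Submission
  imports Defs
begin

text \<open>
  The field operations, the order and the decomposition into real and imaginary parts are
  pointwise, so part (i) and the ordered field axioms hold index by index; the ultrafilter
  enters through the fact that exactly one of a property and its negation holds almost everywhere,
  which gives inverses (\<open>field_star_complex\<close>) and trichotomy (\<open>totally_ordered_star_real\<close>).
  The pointwise square root of a positive family shows that positive elements are squares.

  The two statements about polynomials do not depend on the ultrafilter. A polynomial over a
  quotient of a power \<open>'k\<^sup>I\<close> lifts to a family of polynomials over \<open>'k\<close> of constant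
  degree (\<open>polynomial_family\<close>). Over \<open>\<complex>\<close>, choosing a root at each index yields a root, so every field
  quotient is algebraically closed (\<open>algebraically_closed_quotient\<close>). Over \<open>\<real>\<close>, let \<open>x\<close> be an
  element of a formally real extension that is a root of such a polynomial \<open>p\<close> of degree \<open>n\<close>.
  At each index \<open>p\<^sup>2\<close> is, up to a constant, a product of \<open>n\<close> quadratics \<open>(X - a)\<^sup>2 + b\<^sup>2\<close>, one for
  each complex root \<open>a + b i\<close>. Evaluation of families at \<open>x\<close> is multiplicative (\<open>ev_mult\<close>), so one
  of the \<open>n\<close> families of quadratics vanishes at \<open>x\<close>; since a sum of two squares vanishes in a
  formally real field only if both squares do, \<open>x\<close> equals the class of the family \<open>a\<close>
  (\<open>algebraic_over_real_families\<close>). Hence a formally real algebraic extension cannot be proper.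

  Infinitesimals exist because no test function lies in all the basic sets: the reciprocal of
  the first index at which \<open>\<phi>\<close> leaves them represents one (\<open>infinitesimal_exists\<close>).
\<close>

section \<open>Polynomials over quotients of powers of a field\<close>

text \<open>
  A ring homomorphism \<open>g\<close> from the full power \<open>'k\<^sup>I\<close> of a field into a domain \<open>L\<close>. This is what
  survives of an ultrapower once the ultrafilter is forgotten, and it suffices for both
  statements about polynomials. The assumptions spell out the pointwise ring structure of
  \<open>'k\<^sup>I\<close>, so that families remain plain functions.
\<close>

locale family_hom = domain L for L (structure) +
  fixes g :: "('i \<Rightarrow> 'k::field) \<Rightarrow> 'a"
  assumes g_closed [simp]: "g A \<in> carrier L"
    and g_add: "g (\<lambda>i. A i + B i) = g A \<oplus> g B"
    and g_mult: "g (\<lambda>i. A i * B i) = g A \<otimes> g B"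
    and g_one: "g (\<lambda>_. 1) = \<one>"
begin

lemma g_zero [simp]: "g (\<lambda>_. 0) = \<zero>"
proof -
  have "g (\<lambda>_. 0) \<oplus> g (\<lambda>_. 0) = g (\<lambda>_. 0) \<oplus> \<zero>"
    using g_add[of "\<lambda>_. 0" "\<lambda>_. 0"] by simp
  then show ?thesis
    by (simp del: r_zero)
qed

lemma g_uminus: "g (\<lambda>i. - A i) = \<ominus> g A"
proof -
  have "g (\<lambda>i. - A i) \<oplus> g A = \<zero>"
    using g_add[of "\<lambda>i. - A i" A] by simp
  then show ?thesis
    using minus_equality[of "g (\<lambda>i. - A i)" "g A"] by simp
qed

text \<open>
  If \<open>e\<close> is the indicator of the zero set of \<open>A\<close>, then \<open>A e = 0\<close>, so \<open>g e\<close> vanishes because the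
  target is a domain; \<open>A + e\<close> is therefore another representative, without zeros. This keeps
  leading coefficients from vanishing at isolated indices, so that a polynomial over the image
  of \<open>g\<close> lifts to a family of polynomials of constant degree.
\<close>

lemma nowhere_zero_representative:
  assumes "g A \<noteq> \<zero>"
  obtains B where "g B = g A" and "\<And>i. B i \<noteq> 0"
proof -
  define e where "e i = (if A i = 0 then 1 else 0 :: 'k)" for i
  have "g A \<otimes> g e = g (\<lambda>i. A i * e i)"
    by (simp add: g_mult)
  also have "(\<lambda>i. A i * e i) = (\<lambda>_. 0)"
    by (simp add: e_def fun_eq_iff)
  finally have "g e = \<zero>"
    using assms integral[of "g A" "g e"] by simp
  then have "g (\<lambda>i. A i + e i) = g A"
    by (simp add: g_add)
  moreover have "A i + e i \<noteq> 0" for i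
    by (simp add: e_def)
  ultimately show ?thesis
    using that by blast
qed

text \<open>
  The value at \<open>x\<close> of the polynomial over \<open>L\<close> whose \<open>k\<close>-th coefficient, \<open>k < n\<close>, is the image
  of the family of \<open>k\<close>-th coefficients of \<open>P\<close>. The explicit length \<open>n\<close> is needed because the
  degrees in an arbitrary family may be unbounded; recursion from the leading coefficient
  matches the list evaluation of univariate polynomials over a ring.
\<close>

primrec ev :: "nat \<Rightarrow> ('i \<Rightarrow> 'k poly) \<Rightarrow> 'a \<Rightarrow> 'a" where
  "ev 0 P x = \<zero>"
| "ev (Suc n) P x = g (\<lambda>i. Polynomial.coeff (P i) n) \<otimes> x [^] n \<oplus> ev n P x"

definition bounded_by :: "nat \<Rightarrow> ('i \<Rightarrow> 'k poly) \<Rightarrow> bool" where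
  "bounded_by n P \<longleftrightarrow> (\<forall>i. \<forall>k\<ge>n. Polynomial.coeff (P i) k = 0)"

context
  fixes x assumes x [simp]: "x \<in> carrier L"
begin

lemma ev_closed [simp]: "ev n P x \<in> carrier L"
  by (induction n) auto

lemma ev_extend:
  assumes "bounded_by n P" and "n \<le> m"
  shows "ev m P x = ev n P x"
  using assms(2)
proof (induction m rule: dec_induct)
  case (step m)
  then show ?case
    using assms(1) by (simp add: bounded_by_def)
qed simp

lemma ev_unique_bound:
  assumes "bounded_by n P" and "bounded_by m P"
  shows "ev m P x = ev n P x"
  using ev_extend[OF assms(1)] ev_extend[OF assms(2)] by (metis nle_le)

lemma ev_add: "ev n (\<lambda>i. P i + Q i) x = ev n P x \<oplus> ev n Q x"
  by (induction n) (simp_all add: g_add l_distr a_ac)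

lemma ev_smult: "ev n (\<lambda>i. Polynomial.smult (c i) (P i)) x = g c \<otimes> ev n P x"
  by (induction n) (simp_all add: g_mult r_distr m_assoc)

lemma ev_shift: "ev (Suc n) (\<lambda>i. pCons 0 (P i)) x = x \<otimes> ev n P x"
proof (induction n)
  case (Suc n)
  have "ev (Suc (Suc n)) (\<lambda>i. pCons 0 (P i)) x =
      g (\<lambda>i. Polynomial.coeff (P i) n) \<otimes> (x [^] n \<otimes> x) \<oplus> x \<otimes> ev n P x"
    using Suc by simp
  then show ?case
    by (simp add: r_distr m_ac)
qed simp

lemma ev_const: "ev (Suc n) (\<lambda>i. [:c i:]) x = g c"
  by (induction n) simp_all

lemma ev_pCons: "ev (Suc n) (\<lambda>i. pCons (c i) (P i)) x = g c \<oplus> x \<otimes> ev n P x"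
proof -
  have "(\<lambda>i. pCons (c i) (P i)) = (\<lambda>i. [:c i:] + pCons 0 (P i))"
    by simp
  then show ?thesis
    by (simp only: ev_add ev_const ev_shift)
qed

text \<open>
  Evaluation is multiplicative although \<open>ev\<close> knows the polynomials only through their families
  of coefficients: splitting off the constant terms of \<open>Q\<close> reduces the claim to additivity,
  scaling and the shift by \<open>X\<close>.
\<close>

lemma ev_mult:
  assumes "bounded_by m P" and "bounded_by n Q"
  shows "ev (m + n) (\<lambda>i. P i * Q i) x = ev m P x \<otimes> ev n Q x"
  using assms(2)
proof (induction n arbitrary: Q)
  case 0
  then have "Q i = 0" for i
    by (simp add: bounded_by_def poly_eq_iff)
  then have "ev (m + n) (\<lambda>i. P i * Q i) x = \<zero>" for n
    by (induction n) (simp_all add: ev_extend[of 0 _ m] bounded_by_def)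
  from this[of 0] show ?case
    by simp
next
  case (Suc n)
  define c where "c i = Polynomial.coeff (Q i) 0" for i
  define Q' where "Q' i = poly_shift 1 (Q i)" for i
  have Q: "Q = (\<lambda>i. pCons (c i) (Q' i))"
    by (auto simp: c_def Q'_def poly_eq_iff coeff_pCons coeff_poly_shift split: nat.split)
  have "bounded_by n Q'"
    using Suc.prems by (simp add: bounded_by_def Q'_def coeff_poly_shift)
  then have IH: "ev (m + n) (\<lambda>i. P i * Q' i) x = ev m P x \<otimes> ev n Q' x"
    by (rule Suc.IH)
  have "ev (m + Suc n) (\<lambda>i. P i * Q i) x =
      ev (Suc (m + n)) (\<lambda>i. Polynomial.smult (c i) (P i) + pCons 0 (P i * Q' i)) x"
    by (simp add: Q)
  also have "\<dots> = g c \<otimes> ev m P x \<oplus> x \<otimes> (ev m P x \<otimes> ev n Q' x)"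
    unfolding ev_add ev_smult ev_shift IH using ev_extend[OF assms(1), of "Suc (m + n)"] by simp
  also have "\<dots> = ev m P x \<otimes> ev (Suc n) Q x"
    unfolding Q ev_pCons by (simp add: r_distr m_ac)
  finally show ?case .
qed

lemma eval_eq_ev:
  assumes "set p \<subseteq> carrier L" and "\<And>k. k < length p \<Longrightarrow> g (\<lambda>i. Polynomial.coeff (P i) k) = coeff p k"
  shows "eval p x = ev (length p) P x"
  using assms
proof (induction p)
  case (Cons a p)
  have "coeff (a # p) k = coeff p k" if "k < length p" for k
    using that by simp
  with Cons show ?case
    by (metis (no_types, lifting) coeff.simps(2) diff_Suc_1 ev.simps(2) eval.simps(2) insert_subset
        length_Cons less_Suc_eq list.sel(1,3) list.simps(15))
qed simp

end

text \<open>
  Any representatives of the coefficients would give the right values; taking one without zeros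
  for the leading coefficient fixes the degree, which root finding and factorization need at
  every index.
\<close>

lemma polynomial_family:
  assumes "polynomial (range g) p" and "p \<noteq> []"
  shows "\<exists>P. (\<forall>i. Polynomial.degree (P i) = length p - 1 \<and> P i \<noteq> 0) \<and> bounded_by (length p) P \<and>
    (\<forall>x\<in>carrier L. eval p x = ev (length p) P x)"
proof -
  define n where "n = length p - 1"
  have n: "length p = Suc n"
    using assms(2) by (simp add: n_def)
  have set_p: "set p \<subseteq> range g" and hd_p: "lead_coeff p \<noteq> \<zero>"
    using assms by (auto simp: polynomial_def)
  have "\<exists>B. g B = coeff p k \<and> (k = n \<longrightarrow> (\<forall>i. B i \<noteq> 0))" for k
  proof (cases "k = n")
    case True
    have "hd p \<in> set p" "coeff p n = hd p"
      using assms(2) lead_coeff_simp[of p] by (simp_all add: n_def)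
    then obtain A where A: "g A = coeff p n" "coeff p n \<noteq> \<zero>"
      using set_p hd_p by (metis imageE subsetD)
    with True nowhere_zero_representative[of A] show ?thesis
      by metis
  next
    case False
    show ?thesis
    proof (cases "k < length p")
      case True
      then have "coeff p k \<in> range g"
        using set_p coeff_img(1)[of p]
        by (metis atLeastLessThan_iff imageI subsetD zero_le lessThan_iff lessThan_atLeast0)
      with False show ?thesis
        by auto
    next
      case False
      then have "coeff p k = \<zero>"
        using coeff_length[of p k] by simp
      with \<open>k \<noteq> n\<close> g_zero show ?thesis
        by metis
    qed
  qed
  then obtain c where c: "\<And>k. g (c k) = coeff p k" and cn: "\<And>i. c n i \<noteq> 0"
    by metis
  define P where "P i = (\<Sum>k<Suc n. Polynomial.monom (c k i) k)" for i
  have coeff_P: "Polynomial.coeff (P i) k = (if k \<le> n then c k i else 0)" for i k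
    by (simp add: P_def coeff_sum less_Suc_eq_le)
  show ?thesis
  proof (intro exI conjI allI ballI)
    show "Polynomial.degree (P i) = length p - 1" for i
      unfolding n using cn by (intro antisym degree_le le_degree) (auto simp: coeff_P)
    show "P i \<noteq> 0" for i
      using coeff_P[of i n] cn[of i] by auto
    show "bounded_by (length p) P"
      by (simp add: bounded_by_def n coeff_P)
    show "eval p x = ev (length p) P x" if "x \<in> carrier L" for x
      using that set_p by (intro eval_eq_ev) (auto simp: coeff_P n c)
  qed
qed

text \<open>
  Evaluation involves finitely many ring operations, and \<open>g\<close> commutes with each of them. The
  bound on the degrees is what makes their number the same at all indices.
\<close>

lemma ev_at_family:
  assumes "bounded_by n P"
  shows "ev n P (g z) = g (\<lambda>i. poly (P i) (z i))"
proof -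
  have pow: "g (\<lambda>i. z i ^ k) = g z [^] k" for k
    by (induction k) (simp_all add: g_one g_mult m_comm)
  have "ev m P (g z) = g (\<lambda>i. \<Sum>k<m. Polynomial.coeff (P i) k * z i ^ k)" for m
    by (induction m) (simp_all add: g_add g_mult pow a_comm)
  moreover have "poly (P i) (z i) = (\<Sum>k<n. Polynomial.coeff (P i) k * z i ^ k)" for i
  proof -
    have "(\<Sum>k<n. Polynomial.coeff (P i) k * z i ^ k)
        = (\<Sum>k\<le>Polynomial.degree (P i). Polynomial.coeff (P i) k * z i ^ k)"
      using assms by (intro sum.mono_neutral_cong) (auto simp: bounded_by_def coeff_eq_0 not_less)
    then show ?thesis
      by (simp add: poly_altdef)
  qed
  ultimately show ?thesis
    by simp
qed

end

text \<open>
  A field that is a quotient of a power of an algebraically closed field is algebraically closed: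
  lift a polynomial to a family of nonconstant polynomials, choose a root at each index, and
  take the class of the family of roots.
\<close>

theorem algebraically_closed_quotient:
  fixes F (structure) and g :: "('i \<Rightarrow> 'k::alg_closed_field) \<Rightarrow> 'a"
  assumes "field F" and "family_hom F g" and surj: "range g = carrier F"
  shows "algebraically_closed F"
proof -
  interpret field F by fact
  interpret family_hom F g by fact
  show ?thesis
  proof (rule algebraically_closedI)
    fix p assume p: "p \<in> carrier (poly_ring F)" and deg: "length p - 1 > 1"
    have "polynomial (range g) p"
      using p by (simp add: univ_poly_carrier surj)
    moreover have "p \<noteq> []"
      using deg by auto
    ultimately obtain P where P: "\<And>i. Polynomial.degree (P i) = length p - 1" "bounded_by (length p) P"
      and eval: "\<And>x. x \<in> carrier F \<Longrightarrow> eval p x = ev (length p) P x"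
      using polynomial_family by blast
    have "\<exists>z. poly (P i) z = 0" for i
      using alg_closed_imp_poly_has_root[of "P i"] P(1)[of i] deg by auto
    then obtain z where "\<And>i. poly (P i) (z i) = 0"
      by metis
    then have "eval p (g z) = \<zero>"
      by (simp add: eval ev_at_family P(2))
    then show "\<exists>x\<in>carrier F. eval p x = \<zero>"
      using g_closed by blast
  qed
qed

text \<open>
  Pairing every factor \<open>X - \<gamma>\<close> over \<open>\<complex>\<close> with its conjugate writes the square of a real polynomial
  of degree \<open>n\<close>, up to a constant, as a product of exactly \<open>n\<close> real quadratic factors \<open>(X - Re \<gamma>)\<^sup>2 + (Im \<gamma>)\<^sup>2\<close>.
  Squaring avoids separating the real roots from the pairs of conjugate roots: the shape of the
  factorization depends on the degree alone, hence is the same at all indices of a family.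
\<close>

lemma real_poly_square_decompose:
  fixes p :: "real poly"
  shows "\<exists>\<gamma>. p * p = Polynomial.smult ((Polynomial.lead_coeff p)\<^sup>2)
    (\<Prod>j<Polynomial.degree p. [:(cmod (\<gamma> j))\<^sup>2, - 2 * Re (\<gamma> j), 1:])"
proof -
  obtain \<gamma> where \<gamma>: "Polynomial.smult (of_real (Polynomial.lead_coeff p))
      (\<Prod>j<Polynomial.degree p. [:- \<gamma> j, 1:]) = map_poly complex_of_real p"
    using complex_poly_decompose'[of "map_poly complex_of_real p"]
    by (auto simp: degree_map_poly coeff_map_poly)
  (* Both sides agree at every real t, where p t is real and (p t)^2 = |p t|^2. *)
  have "poly (p * p) t = poly (Polynomial.smult ((Polynomial.lead_coeff p)\<^sup>2)
      (\<Prod>j<Polynomial.degree p. [:(cmod (\<gamma> j))\<^sup>2, - 2 * Re (\<gamma> j), 1:])) t" for t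
  proof -
    have "poly (map_poly complex_of_real p) (of_real t) = of_real (poly p t)"
      by (induction p) (auto simp: map_poly_pCons)
    then have "poly (p * p) t = (cmod (poly (map_poly complex_of_real p) (of_real t)))\<^sup>2"
      by (simp add: power2_eq_square)
    also have "\<dots> = (Polynomial.lead_coeff p)\<^sup>2 * (\<Prod>j<Polynomial.degree p. (cmod (of_real t - \<gamma> j))\<^sup>2)"
      by (simp flip: \<gamma> prod_norm add: poly_prod norm_mult power_mult_distrib prod_power_distrib)
    also have "(\<lambda>j. (cmod (of_real t - \<gamma> j))\<^sup>2) = (\<lambda>j. (cmod (\<gamma> j))\<^sup>2 + t * (t - 2 * Re (\<gamma> j)))"
      unfolding cmod_power2 by (simp add: fun_eq_iff power2_eq_square algebra_simps)
    finally show ?thesis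
      by (simp add: poly_prod algebra_simps)
  qed
  then show ?thesis
    by (auto simp: poly_eq_poly_eq_iff[symmetric] fun_eq_iff intro: exI[of _ \<gamma>])
qed

text \<open>
  A solution with \<open>u \<noteq> 0\<close> would make \<open>- 1\<close> the square of \<open>v / u\<close>.
\<close>

lemma formally_real_sum_two_squares:
  fixes L (structure)
  assumes "formally_real L" and uv: "u \<in> carrier L" "v \<in> carrier L" and sum: "u \<otimes> u \<oplus> v \<otimes> v = \<zero>"
  shows "u = \<zero>"
proof (rule ccontr)
  assume "u \<noteq> \<zero>"
  interpret field L
    using assms(1) by (simp add: formally_real_def)
  define w where "w = v \<otimes> inv u"
  have u: "u \<in> Units L"
    using \<open>u \<noteq> \<zero>\<close> uv field_Units by blast
  then have w: "w \<in> carrier L"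
    using uv by (simp add: w_def)
  have "w \<otimes> w = (v \<otimes> v) \<otimes> (inv u \<otimes> inv u)"
    using u uv by (simp add: w_def m_ac)
  also have "v \<otimes> v = \<ominus> (u \<otimes> u)"
    using sum uv minus_equality[of "v \<otimes> v" "u \<otimes> u"] by (simp add: a_comm)
  also have "\<ominus> (u \<otimes> u) \<otimes> (inv u \<otimes> inv u) = \<ominus> ((u \<otimes> u) \<otimes> (inv u \<otimes> inv u))"
    using u uv by (intro l_minus) auto
  also have "(u \<otimes> u) \<otimes> (inv u \<otimes> inv u) = (u \<otimes> inv u) \<otimes> (u \<otimes> inv u)"
    using u uv by (simp only: m_ac Units_inv_closed m_closed)
  also have "(u \<otimes> inv u) \<otimes> (u \<otimes> inv u) = \<one>"
    using u by simp
  finally have "(\<Oplus>i\<in>{..<1::nat}. w \<otimes> w) = \<ominus> \<one>"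
    using w by (simp add: lessThan_Suc)
  moreover have "(\<lambda>_. w) \<in> {..<1::nat} \<rightarrow> carrier L"
    using w by simp
  ultimately show False
    using assms(1) unfolding formally_real_def by blast
qed

context family_hom
begin

lemma bounded_byI: "(\<And>i. Polynomial.degree (P i) < n) \<Longrightarrow> bounded_by n P"
  by (auto simp: bounded_by_def intro: coeff_eq_0 less_le_trans)

text \<open>
  The two lengths are one more than the degree bounds of the product and of a single factor,
  since \<open>ev\<close> counts coefficients.
\<close>

lemma ev_prod_eq_zero:
  assumes x: "x \<in> carrier L" and deg: "\<And>j i. Polynomial.degree (Q j i) \<le> d"
    and "ev (Suc (n * d)) (\<lambda>i. \<Prod>j<n. Q j i) x = \<zero>"
  shows "\<exists>j<n. ev (Suc d) (Q j) x = \<zero>"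
  using assms(3)
proof (induction n)
  case 0
  then show ?case
    using ev_const[OF x, of 0 "\<lambda>_. 1"] by (simp add: g_one one_pCons)
next
  case (Suc n)
  let ?P = "\<lambda>n i. \<Prod>j<n. Q j i"
  have bdd: "bounded_by (Suc (n * d)) (?P n)" for n
  proof (rule bounded_byI)
    fix i
    have "Polynomial.degree (?P n i) \<le> (\<Sum>j<n. Polynomial.degree (Q j i))"
      using degree_prod_sum_le[of "{..<n}" "\<lambda>j. Q j i"] by (simp add: o_def)
    also have "\<dots> \<le> (\<Sum>j<n. d)"
      by (intro sum_mono deg)
    finally show "Polynomial.degree (?P n i) < Suc (n * d)"
      by simp
  qed
  have Q: "bounded_by (Suc d) (Q n)"
    using deg by (intro bounded_byI) (simp add: less_Suc_eq_le)
  have "bounded_by (Suc (n * d) + Suc d) (?P (Suc n))"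
    using bdd[of "Suc n"] by (simp add: bounded_by_def)
  from ev_unique_bound[OF x bdd this] Suc.prems
  have "ev (Suc (n * d) + Suc d) (\<lambda>i. ?P n i * Q n i) x = \<zero>"
    by simp
  then have "ev (Suc (n * d)) (?P n) x = \<zero> \<or> ev (Suc d) (Q n) x = \<zero>"
    unfolding ev_mult[OF x bdd Q] using x by (intro integral) auto
  then show ?case
    using Suc.IH less_Suc_eq by blast
qed

end

text \<open>
  The left-hand side is the Horner form in which \<open>ev\<close> presents a monic quadratic.
\<close>

lemma (in cring) shifted_sum_of_squares:
  assumes x: "x \<in> carrier R" and a: "a \<in> carrier R" and b: "b \<in> carrier R"
  shows "a \<otimes> a \<oplus> b \<otimes> b \<oplus> x \<otimes> (\<ominus> (a \<oplus> a) \<oplus> x \<otimes> \<one>) = (x \<ominus> a) \<otimes> (x \<ominus> a) \<oplus> b \<otimes> b"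
proof -
  have "(x \<ominus> a) \<otimes> (x \<ominus> a) = x \<otimes> x \<oplus> \<ominus> (x \<otimes> a) \<oplus> (\<ominus> (x \<otimes> a) \<oplus> a \<otimes> a)"
    using x a by (simp add: a_minus_def l_distr r_distr l_minus r_minus minus_add m_comm[of a x])
  also have "\<dots> = a \<otimes> a \<oplus> (\<ominus> (x \<otimes> a) \<oplus> \<ominus> (x \<otimes> a) \<oplus> x \<otimes> x)"
    using x a by (simp add: a_ac)
  also have "\<ominus> (x \<otimes> a) \<oplus> \<ominus> (x \<otimes> a) \<oplus> x \<otimes> x = x \<otimes> (\<ominus> (a \<oplus> a) \<oplus> x \<otimes> \<one>)"
    using x a by (simp add: r_minus r_distr minus_add)
  finally have "(x \<ominus> a) \<otimes> (x \<ominus> a) = a \<otimes> a \<oplus> x \<otimes> (\<ominus> (a \<oplus> a) \<oplus> x \<otimes> \<one>)" .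
  moreover have "m \<oplus> n \<oplus> k = m \<oplus> k \<oplus> n"
    if "m \<in> carrier R" "n \<in> carrier R" "k \<in> carrier R" for m n k
    using that by (simp add: a_ac)
  ultimately show ?thesis
    using x a b by simp
qed

text \<open>
  If \<open>x\<close> is a root of a polynomial \<open>p\<close> over the image of \<open>\<real>\<^sup>I\<close>, then it is a root of \<open>p\<^sup>2\<close>, which
  factors into quadratics \<open>(X - a)\<^sup>2 + b\<^sup>2\<close> with \<open>a\<close> and \<open>b\<close> in the image. One factor vanishes at
  \<open>x\<close>, and formal reality turns \<open>(x - a)\<^sup>2 + b\<^sup>2 = 0\<close> into \<open>x = a\<close>.
\<close>

theorem algebraic_over_real_families:
  fixes L (structure) and g :: "('i \<Rightarrow> real) \<Rightarrow> 'a"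
  assumes "formally_real L" and "family_hom L g"
    and x: "x \<in> carrier L" and alg: "(ring.algebraic L over range g) x" and "subring (range g) L"
  shows "x \<in> range g"
proof -
  interpret family_hom L g by fact
  obtain p where "p \<in> carrier ((range g)[X])" and "p \<noteq> []" and root: "eval p x = \<zero>"
    using algebraicE[OF assms(5) x alg] by auto
  then have "polynomial (range g) p"
    by (simp add: univ_poly_carrier)
  then obtain P where P: "\<And>i. Polynomial.degree (P i) = length p - 1" "\<And>i. P i \<noteq> 0" "bounded_by (length p) P"
    and eval: "\<And>x. x \<in> carrier L \<Longrightarrow> eval p x = ev (length p) P x"
    using polynomial_family \<open>p \<noteq> []\<close> by blast
  from root eval[OF x] have root: "ev (length p) P x = \<zero>"
    by simp
  define n where "n = length p - 1"
  define c where "c i = (Polynomial.lead_coeff (P i))\<^sup>2" for i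
  have "\<forall>i. \<exists>\<gamma>. P i * P i = Polynomial.smult (c i) (\<Prod>j<n. [:(cmod (\<gamma> j))\<^sup>2, - 2 * Re (\<gamma> j), 1:])"
    using real_poly_square_decompose[of "P _"] by (simp add: P(1) n_def c_def)
  then obtain \<gamma> where \<gamma>: "\<And>i. P i * P i =
      Polynomial.smult (c i) (\<Prod>j<n. [:(cmod (\<gamma> i j))\<^sup>2, - 2 * Re (\<gamma> i j), 1:])"
    using choice[where Q = "\<lambda>i \<gamma>. P i * P i =
      Polynomial.smult (c i) (\<Prod>j<n. [:(cmod (\<gamma> j))\<^sup>2, - 2 * Re (\<gamma> j), 1:])"] by blast
  define Q where "Q j i = [:(cmod (\<gamma> i j))\<^sup>2, - 2 * Re (\<gamma> i j), 1:]" for j i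
  have sq_root: "ev (length p + length p) (\<lambda>i. P i * P i) x = \<zero>"
    using ev_mult[OF x P(3) P(3)] root by simp
  have deg_sq: "Polynomial.degree (P i * P i) = 2 * n" for i
    using P by (simp add: degree_mult_eq n_def)
  (* Multiplicativity yields 2 n + 2 coefficients, one more than a product of n quadratics has. *)
  have "bounded_by (length p + length p) (\<lambda>i. P i * P i)"
    using \<open>p \<noteq> []\<close> by (intro bounded_byI) (simp only: deg_sq n_def, cases p, auto)
  moreover have "bounded_by (Suc (n * 2)) (\<lambda>i. P i * P i)"
    by (intro bounded_byI) (simp add: deg_sq)
  ultimately have "ev (Suc (n * 2)) (\<lambda>i. P i * P i) x = \<zero>"
    using sq_root ev_unique_bound[OF x] by metis
  then have "g c \<otimes> ev (Suc (n * 2)) (\<lambda>i. \<Prod>j<n. Q j i) x = \<zero>"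
    by (simp only: \<gamma> Q_def[symmetric] ev_smult[OF x])
  moreover have "g c \<noteq> \<zero>"
  proof
    assume "g c = \<zero>"
    moreover have "g c \<otimes> g (\<lambda>i. 1 / c i) = \<one>"
      using P(2) by (simp flip: g_mult g_one add: c_def)
    ultimately show False
      by simp
  qed
  ultimately have "ev (Suc (n * 2)) (\<lambda>i. \<Prod>j<n. Q j i) x = \<zero>"
    using x integral[of "g c"] by auto
  then obtain j where j: "ev (Suc 2) (Q j) x = \<zero>"
    using ev_prod_eq_zero[OF x, of Q 2 n] by (auto simp: Q_def)
  define A where "A i = Re (\<gamma> i j)" for i
  define B where "B i = Im (\<gamma> i j)" for i
  have "Q j = (\<lambda>i. [:A i * A i + B i * B i, - (A i + A i), 1:])"
    unfolding Q_def A_def B_def cmod_power2 by (simp add: power2_eq_square)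
  then have "ev (Suc 2) (Q j) x = g (\<lambda>i. A i * A i + B i * B i) \<oplus> x \<otimes> (g (\<lambda>i. - (A i + A i)) \<oplus> x \<otimes> \<one>)"
    by (simp only: numeral_2_eq_2 ev_pCons[OF x] ev.simps(1) g_one r_null[OF x] r_zero one_closed)
  then have "ev (Suc 2) (Q j) x = (x \<ominus> g A) \<otimes> (x \<ominus> g A) \<oplus> g B \<otimes> g B"
    by (simp only: g_add[of "\<lambda>i. A i * A i" "\<lambda>i. B i * B i"] g_mult[of A A] g_mult[of B B]
        g_uminus[of "\<lambda>i. A i + A i"] g_add[of A A] shifted_sum_of_squares[OF x g_closed g_closed])
  with j have "(x \<ominus> g A) \<otimes> (x \<ominus> g A) \<oplus> g B \<otimes> g B = \<zero>"
    by (simp only:)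
  then have "x \<ominus> g A = \<zero>"
    by (rule formally_real_sum_two_squares[OF assms(1) minus_closed[OF x g_closed] g_closed])
  then have "x = g A"
    using x by simp
  then show ?thesis
    by simp
qed

lemma subfield_image_hom:
  assumes "field K" and "field F" and "h \<in> ring_hom K F"
  shows "subfield (h ` carrier K) F"
proof -
  interpret K: field K
    by fact
  interpret F: field F
    by fact
  interpret ring_hom_ring K F h
    using assms(3) by (intro ring_hom_ringI2) (auto intro: K.ring_axioms F.ring_axioms)
  show ?thesis
    using img_is_subfield(2)[OF K.carrier_is_subfield] F.one_not_zero by simp
qed

section \<open>Computing with representatives\<close>

lemma equiv_star_rel: "equiv UNIV (star_rel \<U>)"
proof (rule equivI)
  show "trans (star_rel \<U>)"
    unfolding star_rel_def
    by (intro transI) (auto elim: eventually_elim2)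
qed (auto simp: star_rel_def refl_on_def sym_def elim: eventually_mono)

lemma star_class_eq_iff: "star_class \<U> A = star_class \<U> B \<longleftrightarrow> (\<forall>\<^sub>F \<phi> in \<U>. A \<phi> = B \<phi>)"
  using eq_equiv_class_iff[OF equiv_star_rel, of A B \<U>] by (simp add: star_class_def star_rel_def)

lemma mem_star_class_iff: "B \<in> star_class \<U> A \<longleftrightarrow> (\<forall>\<^sub>F \<phi> in \<U>. A \<phi> = B \<phi>)"
  by (simp add: star_class_def star_rel_def)

lemma star_map_star_class: "star_map \<U> f (star_class \<U> A) = star_class \<U> (\<lambda>\<phi>. f (A \<phi>))"
proof -
  have "star_class \<U> (\<lambda>\<phi>. f (A' \<phi>)) = star_class \<U> (\<lambda>\<phi>. f (A \<phi>))" if "A' \<in> star_class \<U> A" for A'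
    using that by (auto simp: mem_star_class_iff star_class_eq_iff elim: eventually_mono)
  moreover have "A \<in> star_class \<U> A"
    by (simp add: mem_star_class_iff)
  ultimately show ?thesis
    unfolding star_map_def by blast
qed

lemma star_map2_star_class:
  "star_map2 \<U> f (star_class \<U> A) (star_class \<U> B) = star_class \<U> (\<lambda>\<phi>. f (A \<phi>) (B \<phi>))"
proof -
  have "star_class \<U> (\<lambda>\<phi>. f (A' \<phi>) (B' \<phi>)) = star_class \<U> (\<lambda>\<phi>. f (A \<phi>) (B \<phi>))"
    if "A' \<in> star_class \<U> A" "B' \<in> star_class \<U> B" for A' B'
    using that by (auto simp: mem_star_class_iff star_class_eq_iff elim: eventually_elim2)
  moreover have "A \<in> star_class \<U> A" "B \<in> star_class \<U> B"
    by (simp_all add: mem_star_class_iff)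
  ultimately show ?thesis
    unfolding star_map2_def by blast
qed

lemma carrier_star_complex: "carrier (star_complex \<U>) = range (star_class \<U>)"
  by (auto simp: star_complex_def quotient_def star_class_def)

lemma star_complex_ops:
  "star_class \<U> A \<otimes>\<^bsub>star_complex \<U>\<^esub> star_class \<U> B = star_class \<U> (\<lambda>\<phi>. A \<phi> * B \<phi>)"
  "star_class \<U> A \<oplus>\<^bsub>star_complex \<U>\<^esub> star_class \<U> B = star_class \<U> (\<lambda>\<phi>. A \<phi> + B \<phi>)"
  "\<one>\<^bsub>star_complex \<U>\<^esub> = star_class \<U> (\<lambda>_. 1)"
  "\<zero>\<^bsub>star_complex \<U>\<^esub> = star_class \<U> (\<lambda>_. 0)"
  by (simp_all add: star_complex_def star_map2_star_class star_embed_def)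

text \<open>
  Every non-standard real has a representative that is real at all indices, so that facts
  about non-standard reals become facts about families in \<open>\<real>\<close>.
\<close>

definition real_class :: "('n::finite) test_fun filter \<Rightarrow> ('n test_fun \<Rightarrow> real) \<Rightarrow> 'n family set" where
  "real_class \<U> a = star_class \<U> (\<lambda>\<phi>. complex_of_real (a \<phi>))"

lemma real_class_eq_iff: "real_class \<U> a = real_class \<U> b \<longleftrightarrow> (\<forall>\<^sub>F \<phi> in \<U>. a \<phi> = b \<phi>)"
  by (simp add: real_class_def star_class_eq_iff)

lemma carrier_star_real: "carrier (star_real \<U>) = range (real_class \<U>)"
proof -
  have "star_class \<U> A \<in> range (real_class \<U>)" if "\<forall>\<^sub>F \<phi> in \<U>. A \<phi> \<in> \<real>" for A
  proof -
    have "star_class \<U> A = real_class \<U> (\<lambda>\<phi>. Re (A \<phi>))"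
      using that by (auto simp: real_class_def star_class_eq_iff elim: eventually_mono)
    then show ?thesis
      by blast
  qed
  moreover have "\<exists>A. real_class \<U> a = star_class \<U> A \<and> (\<forall>\<^sub>F \<phi> in \<U>. A \<phi> \<in> \<real>)" for a
    by (auto simp: real_class_def intro!: exI[of _ "\<lambda>\<phi>. complex_of_real (a \<phi>)"])
  ultimately show ?thesis
    by (auto simp: star_real_def)
qed

lemma star_real_ops:
  "real_class \<U> a \<otimes>\<^bsub>star_real \<U>\<^esub> real_class \<U> b = real_class \<U> (\<lambda>\<phi>. a \<phi> * b \<phi>)"
  "real_class \<U> a \<oplus>\<^bsub>star_real \<U>\<^esub> real_class \<U> b = real_class \<U> (\<lambda>\<phi>. a \<phi> + b \<phi>)"
  "\<one>\<^bsub>star_real \<U>\<^esub> = real_class \<U> (\<lambda>_. 1)"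
  "\<zero>\<^bsub>star_real \<U>\<^esub> = real_class \<U> (\<lambda>_. 0)"
  by (simp_all add: star_real_def real_class_def star_complex_ops)

lemma real_class_power2:
  "real_class \<U> a [^]\<^bsub>star_real \<U>\<^esub> (2::nat) = real_class \<U> (\<lambda>\<phi>. (a \<phi>)\<^sup>2)"
  by (simp add: nat_pow_def numeral_2_eq_2 star_real_ops power2_eq_square)

lemma star_Re_star_class: "star_Re \<U> (star_class \<U> A) = real_class \<U> (\<lambda>\<phi>. Re (A \<phi>))"
  by (simp add: star_Re_def star_map_star_class real_class_def)

lemma star_Im_star_class: "star_Im \<U> (star_class \<U> A) = real_class \<U> (\<lambda>\<phi>. Im (A \<phi>))"
  by (simp add: star_Im_def star_map_star_class real_class_def)

lemma star_abs_star_class: "star_abs \<U> (star_class \<U> A) = real_class \<U> (\<lambda>\<phi>. cmod (A \<phi>))"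
  by (simp add: star_abs_def star_map_star_class real_class_def)

lemma star_embed_of_real: "star_embed \<U> (complex_of_real r) = real_class \<U> (\<lambda>_. r)"
  by (simp add: star_embed_def real_class_def)

lemma cartesian_form:
  "real_class \<U> a \<oplus>\<^bsub>star_complex \<U>\<^esub> real_class \<U> b \<otimes>\<^bsub>star_complex \<U>\<^esub> star_embed \<U> \<i> =
     star_class \<U> (\<lambda>\<phi>. Complex (a \<phi>) (b \<phi>))"
  by (simp add: real_class_def star_embed_def star_complex_ops Complex_eq mult.commute)

section \<open>The ordered field structure\<close>

locale star_construction =
  fixes \<U> :: "('n::finite) test_fun filter"
  assumes ultra: "ultrafilter \<U>"
begin

lemma not_bot: "\<U> \<noteq> bot"
  using ultra by (simp add: ultrafilter_def)

lemma eventually_const_iff [simp]: "(\<forall>\<^sub>F \<phi> in \<U>. P) \<longleftrightarrow> P"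
  using not_bot by simp

lemma eventually_not_iff: "(\<forall>\<^sub>F \<phi> in \<U>. \<not> P \<phi>) \<longleftrightarrow> \<not> (\<forall>\<^sub>F \<phi> in \<U>. P \<phi>)"
proof
  assume *: "\<forall>\<^sub>F \<phi> in \<U>. \<not> P \<phi>"
  show "\<not> (\<forall>\<^sub>F \<phi> in \<U>. P \<phi>)"
  proof
    assume "\<forall>\<^sub>F \<phi> in \<U>. P \<phi>"
    with * have "\<forall>\<^sub>F \<phi> in \<U>. False"
      by (rule eventually_elim2) simp
    then show False
      by simp
  qed
qed (use ultra in \<open>auto simp: ultrafilter_def\<close>)

text \<open>
  The disjunction property of an ultrafilter is what transfers trichotomy.
\<close>

lemma eventually_disj_iff:
  "(\<forall>\<^sub>F \<phi> in \<U>. P \<phi> \<or> Q \<phi>) \<longleftrightarrow> (\<forall>\<^sub>F \<phi> in \<U>. P \<phi>) \<or> (\<forall>\<^sub>F \<phi> in \<U>. Q \<phi>)"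
proof -
  have "\<not> (\<forall>\<^sub>F \<phi> in \<U>. P \<phi> \<or> Q \<phi>) \<longleftrightarrow> (\<forall>\<^sub>F \<phi> in \<U>. \<not> P \<phi> \<and> \<not> Q \<phi>)"
    by (simp flip: eventually_not_iff)
  then show ?thesis
    by (auto simp: eventually_conj_iff eventually_not_iff)
qed

text \<open>
  A family whose class is not zero is nonzero almost everywhere, because \<open>\<U>\<close> is an ultrafilter;
  its pointwise inverse, with the default value at the exceptional indices, represents the
  inverse.
\<close>

lemma field_star_complex: "field (star_complex \<U>)"
proof -
  have "cring (star_complex \<U>)"
  proof (rule cringI)
    show "abelian_group (star_complex \<U>)"
    proof (rule abelian_groupI)
      fix x assume "x \<in> carrier (star_complex \<U>)"
      then obtain A where "x = star_class \<U> A"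
        by (auto simp: carrier_star_complex)
      then have "star_class \<U> (\<lambda>\<phi>. - A \<phi>) \<oplus>\<^bsub>star_complex \<U>\<^esub> x = \<zero>\<^bsub>star_complex \<U>\<^esub>"
        by (simp add: star_complex_ops)
      then show "\<exists>y\<in>carrier (star_complex \<U>). y \<oplus>\<^bsub>star_complex \<U>\<^esub> x = \<zero>\<^bsub>star_complex \<U>\<^esub>"
        by (auto simp: carrier_star_complex)
    qed (auto simp: carrier_star_complex star_complex_ops algebra_simps)
    show "Group.comm_monoid (star_complex \<U>)"
      by (rule comm_monoidI) (auto simp: carrier_star_complex star_complex_ops algebra_simps)
  qed (auto simp: carrier_star_complex star_complex_ops algebra_simps)
  then show ?thesis
  proof (rule cring.cring_fieldI2)
    show "\<zero>\<^bsub>star_complex \<U>\<^esub> \<noteq> \<one>\<^bsub>star_complex \<U>\<^esub>"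
      by (simp add: star_complex_ops star_class_eq_iff)
  next
    fix x assume "x \<in> carrier (star_complex \<U>)" and "x \<noteq> \<zero>\<^bsub>star_complex \<U>\<^esub>"
    moreover from this obtain A where x: "x = star_class \<U> A"
      by (auto simp: carrier_star_complex)
    ultimately have A: "\<forall>\<^sub>F \<phi> in \<U>. A \<phi> \<noteq> 0"
      by (simp add: star_complex_ops star_class_eq_iff eventually_not_iff)
    from this have "x \<otimes>\<^bsub>star_complex \<U>\<^esub> star_class \<U> (\<lambda>\<phi>. inverse (A \<phi>)) = \<one>\<^bsub>star_complex \<U>\<^esub>"
      by (auto simp: x star_complex_ops star_class_eq_iff elim!: eventually_mono)
    then show "\<exists>y\<in>carrier (star_complex \<U>). x \<otimes>\<^bsub>star_complex \<U>\<^esub> y = \<one>\<^bsub>star_complex \<U>\<^esub>"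
      by (auto simp: carrier_star_complex)
  qed
qed

sublocale C: field "star_complex \<U>"
  by (rule field_star_complex)

lemma star_class_closed [simp]: "star_class \<U> A \<in> carrier (star_complex \<U>)"
  by (simp add: carrier_star_complex)

lemma star_class_uminus: "\<ominus>\<^bsub>star_complex \<U>\<^esub> star_class \<U> A = star_class \<U> (\<lambda>\<phi>. - A \<phi>)"
  by (rule C.minus_equality) (simp_all add: star_complex_ops)

lemma star_class_minus:
  "star_class \<U> A \<ominus>\<^bsub>star_complex \<U>\<^esub> star_class \<U> B = star_class \<U> (\<lambda>\<phi>. A \<phi> - B \<phi>)"
  by (simp add: a_minus_def star_class_uminus star_complex_ops)

lemma subfield_star_real: "subfield (carrier (star_real \<U>)) (star_complex \<U>)"
proof (rule C.subfieldI')
  show "subring (carrier (star_real \<U>)) (star_complex \<U>)"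
  proof (rule C.subringI)
    show "\<one>\<^bsub>star_complex \<U>\<^esub> \<in> carrier (star_real \<U>)"
      unfolding carrier_star_real
      by (rule range_eqI[of _ _ "\<lambda>_. 1"]) (simp add: real_class_def star_complex_ops)
  next
    fix h assume "h \<in> carrier (star_real \<U>)"
    then obtain a where "h = real_class \<U> a"
      by (auto simp: carrier_star_real)
    then have "\<ominus>\<^bsub>star_complex \<U>\<^esub> h = real_class \<U> (\<lambda>\<phi>. - a \<phi>)"
      by (simp add: real_class_def star_class_uminus)
    then show "\<ominus>\<^bsub>star_complex \<U>\<^esub> h \<in> carrier (star_real \<U>)"
      by (simp add: carrier_star_real)
  next
    fix h k assume "h \<in> carrier (star_real \<U>)" "k \<in> carrier (star_real \<U>)"
    then obtain a b where "h = real_class \<U> a" "k = real_class \<U> b"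
      by (auto simp: carrier_star_real)
    then have "h \<otimes>\<^bsub>star_complex \<U>\<^esub> k = real_class \<U> (\<lambda>\<phi>. a \<phi> * b \<phi>)"
      and "h \<oplus>\<^bsub>star_complex \<U>\<^esub> k = real_class \<U> (\<lambda>\<phi>. a \<phi> + b \<phi>)"
      by (simp_all add: real_class_def star_complex_ops)
    then show "h \<otimes>\<^bsub>star_complex \<U>\<^esub> k \<in> carrier (star_real \<U>)"
      and "h \<oplus>\<^bsub>star_complex \<U>\<^esub> k \<in> carrier (star_real \<U>)"
      by (simp_all add: carrier_star_real)
  qed (auto simp: carrier_star_real real_class_def)
next
  fix k assume k: "k \<in> carrier (star_real \<U>) - {\<zero>\<^bsub>star_complex \<U>\<^esub>}"
  then obtain a where a: "k = real_class \<U> a"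
    by (auto simp: carrier_star_real)
  then have "\<forall>\<^sub>F \<phi> in \<U>. a \<phi> \<noteq> 0"
    using k by (simp add: star_complex_ops real_class_def star_class_eq_iff eventually_not_iff)
  then have "k \<otimes>\<^bsub>star_complex \<U>\<^esub> real_class \<U> (\<lambda>\<phi>. inverse (a \<phi>)) = \<one>\<^bsub>star_complex \<U>\<^esub>"
    by (auto simp: a real_class_def star_complex_ops star_class_eq_iff elim!: eventually_mono)
  then have "inv\<^bsub>star_complex \<U>\<^esub> k = real_class \<U> (\<lambda>\<phi>. inverse (a \<phi>))"
    by (intro C.comm_inv_char) (simp_all add: a real_class_def)
  then show "inv\<^bsub>star_complex \<U>\<^esub> k \<in> carrier (star_real \<U>)"
    by (simp add: carrier_star_real)
qed

lemma field_star_real: "field (star_real \<U>)"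
  using C.subfield_iff(2)[OF subfield_star_real] by (simp add: star_real_def)

sublocale R: field "star_real \<U>"
  by (rule field_star_real)

lemma real_class_closed [simp]: "real_class \<U> a \<in> carrier (star_real \<U>)"
  by (simp add: carrier_star_real)

lemma star_less_real_class: "star_less \<U> (real_class \<U> a) (real_class \<U> b) \<longleftrightarrow> (\<forall>\<^sub>F \<phi> in \<U>. a \<phi> < b \<phi>)"
proof -
  have eq: "real_class \<U> b \<ominus>\<^bsub>star_complex \<U>\<^esub> real_class \<U> a = star_class \<U> (\<lambda>\<phi>. of_real (b \<phi> - a \<phi>))"
    by (simp add: real_class_def star_class_minus)
  have "star_pos \<U> (star_class \<U> (\<lambda>\<phi>. of_real (c \<phi>))) \<longleftrightarrow> (\<forall>\<^sub>F \<phi> in \<U>. 0 < c \<phi>)" for c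
  proof
    assume "star_pos \<U> (star_class \<U> (\<lambda>\<phi>. of_real (c \<phi>)))"
    then obtain A where "\<forall>\<^sub>F \<phi> in \<U>. of_real (c \<phi>) = A \<phi>" "\<forall>\<^sub>F \<phi> in \<U>. A \<phi> \<in> \<real> \<and> 0 < Re (A \<phi>)"
      by (auto simp: star_pos_def mem_star_class_iff)
    then show "\<forall>\<^sub>F \<phi> in \<U>. 0 < c \<phi>"
      by (rule eventually_elim2) (metis Re_complex_of_real)
  next
    assume "\<forall>\<^sub>F \<phi> in \<U>. 0 < c \<phi>"
    then show "star_pos \<U> (star_class \<U> (\<lambda>\<phi>. of_real (c \<phi>)))"
      unfolding star_pos_def
      by (intro bexI[of _ "\<lambda>\<phi>. of_real (c \<phi>)"]) (simp_all add: mem_star_class_iff)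
  qed
  from this[of "\<lambda>\<phi>. b \<phi> - a \<phi>"] show ?thesis
    unfolding star_less_def eq by simp
qed

lemma totally_ordered_star_real: "totally_ordered_field (star_real \<U>) (star_less \<U>)"
proof
  fix x assume "x \<in> carrier (star_real \<U>)"
  then show "\<not> star_less \<U> x x"
    by (auto simp: carrier_star_real star_less_real_class)
next
  fix x y z assume "x \<in> carrier (star_real \<U>)" "y \<in> carrier (star_real \<U>)" "z \<in> carrier (star_real \<U>)"
    and "star_less \<U> x y" "star_less \<U> y z"
  then show "star_less \<U> x z"
    by (auto simp: carrier_star_real star_less_real_class elim: eventually_elim2[OF _ _ less_trans])
next
  fix x y assume "x \<in> carrier (star_real \<U>)" "y \<in> carrier (star_real \<U>)"
  then obtain a b where "x = real_class \<U> a" "y = real_class \<U> b"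
    by (auto simp: carrier_star_real)
  moreover have "\<forall>\<^sub>F \<phi> in \<U>. a \<phi> < b \<phi> \<or> a \<phi> = b \<phi> \<or> b \<phi> < a \<phi>"
    by (intro always_eventually) auto
  ultimately show "star_less \<U> x y \<or> x = y \<or> star_less \<U> y x"
    by (simp add: star_less_real_class real_class_eq_iff eventually_disj_iff)
next
  fix x y z assume "x \<in> carrier (star_real \<U>)" "y \<in> carrier (star_real \<U>)" "z \<in> carrier (star_real \<U>)"
    and "star_less \<U> x y"
  then show "star_less \<U> (x \<oplus>\<^bsub>star_real \<U>\<^esub> z) (y \<oplus>\<^bsub>star_real \<U>\<^esub> z)"
    by (auto simp: carrier_star_real star_real_ops star_less_real_class)
next
  fix x y assume "x \<in> carrier (star_real \<U>)" "y \<in> carrier (star_real \<U>)"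
    and "star_less \<U> \<zero>\<^bsub>star_real \<U>\<^esub> x" "star_less \<U> \<zero>\<^bsub>star_real \<U>\<^esub> y"
  then show "star_less \<U> \<zero>\<^bsub>star_real \<U>\<^esub> (x \<otimes>\<^bsub>star_real \<U>\<^esub> y)"
    by (auto simp: carrier_star_real star_real_ops star_less_real_class elim: eventually_elim2[OF _ _ mult_pos_pos])
qed

lemma star_sqrt_real_class:
  assumes "\<And>\<phi>. 0 \<le> a \<phi>"
  shows "star_sqrt \<U> (real_class \<U> a) = real_class \<U> (\<lambda>\<phi>. sqrt (a \<phi>))"
proof -
  have nonneg: "real_class \<U> s = \<zero>\<^bsub>star_real \<U>\<^esub> \<or> star_less \<U> \<zero>\<^bsub>star_real \<U>\<^esub> (real_class \<U> s)
      \<longleftrightarrow> (\<forall>\<^sub>F \<phi> in \<U>. 0 \<le> s \<phi>)" for s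
  proof -
    have "(\<forall>\<^sub>F \<phi> in \<U>. 0 \<le> s \<phi>) \<longleftrightarrow> (\<forall>\<^sub>F \<phi> in \<U>. s \<phi> = 0 \<or> 0 < s \<phi>)"
      by (intro arg_cong[where f = "\<lambda>P. eventually P \<U>"]) auto
    then show ?thesis
      by (simp add: star_real_ops real_class_eq_iff star_less_real_class eventually_disj_iff)
  qed
  show ?thesis
    unfolding star_sqrt_def
  proof (rule the_equality)
    show "real_class \<U> (\<lambda>\<phi>. sqrt (a \<phi>)) \<in> carrier (star_real \<U>) \<and>
        (real_class \<U> (\<lambda>\<phi>. sqrt (a \<phi>)) = \<zero>\<^bsub>star_real \<U>\<^esub> \<or>
         star_less \<U> \<zero>\<^bsub>star_real \<U>\<^esub> (real_class \<U> (\<lambda>\<phi>. sqrt (a \<phi>)))) \<and>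
        real_class \<U> (\<lambda>\<phi>. sqrt (a \<phi>)) [^]\<^bsub>star_real \<U>\<^esub> (2::nat) = real_class \<U> a"
      unfolding nonneg using assms by (simp add: real_class_power2)
  next
    fix s assume s: "s \<in> carrier (star_real \<U>) \<and>
        (s = \<zero>\<^bsub>star_real \<U>\<^esub> \<or> star_less \<U> \<zero>\<^bsub>star_real \<U>\<^esub> s) \<and>
        s [^]\<^bsub>star_real \<U>\<^esub> (2::nat) = real_class \<U> a"
    then obtain b where b: "s = real_class \<U> b"
      by (auto simp: carrier_star_real)
    have "\<forall>\<^sub>F \<phi> in \<U>. 0 \<le> b \<phi>" "\<forall>\<^sub>F \<phi> in \<U>. (b \<phi>)\<^sup>2 = a \<phi>"
      using s nonneg[of b] by (auto simp: b real_class_power2 real_class_eq_iff)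
    then have "\<forall>\<^sub>F \<phi> in \<U>. b \<phi> = sqrt (a \<phi>)"
      by (rule eventually_elim2) (simp add: real_sqrt_unique)
    then show "s = real_class \<U> (\<lambda>\<phi>. sqrt (a \<phi>))"
      by (simp add: b real_class_eq_iff)
  qed
qed

lemma pos_iff_nonzero_square:
  assumes "\<alpha> \<in> carrier (star_real \<U>)"
  shows "star_less \<U> \<zero>\<^bsub>star_real \<U>\<^esub> \<alpha> \<longleftrightarrow>
    (\<exists>\<beta>\<in>carrier (star_real \<U>). \<beta> \<noteq> \<zero>\<^bsub>star_real \<U>\<^esub> \<and> \<alpha> = \<beta> [^]\<^bsub>star_real \<U>\<^esub> (2::nat))"
proof
  obtain a where a: "\<alpha> = real_class \<U> a"
    using assms by (auto simp: carrier_star_real)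
  assume "star_less \<U> \<zero>\<^bsub>star_real \<U>\<^esub> \<alpha>"
  then have pos: "\<forall>\<^sub>F \<phi> in \<U>. 0 < a \<phi>"
    by (simp add: a star_real_ops star_less_real_class)
  define \<beta> where "\<beta> = real_class \<U> (\<lambda>\<phi>. sqrt (a \<phi>))"
  have "\<beta> \<noteq> \<zero>\<^bsub>star_real \<U>\<^esub>"
  proof -
    have "\<forall>\<^sub>F \<phi> in \<U>. sqrt (a \<phi>) \<noteq> 0"
      using pos by (rule eventually_mono) simp
    then show ?thesis
      by (simp add: \<beta>_def star_real_ops real_class_eq_iff eventually_not_iff)
  qed
  moreover have "\<alpha> = \<beta> [^]\<^bsub>star_real \<U>\<^esub> (2::nat)"
    using pos by (auto simp: a \<beta>_def real_class_power2 real_class_eq_iff elim: eventually_mono)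
  ultimately show "\<exists>\<beta>\<in>carrier (star_real \<U>). \<beta> \<noteq> \<zero>\<^bsub>star_real \<U>\<^esub> \<and> \<alpha> = \<beta> [^]\<^bsub>star_real \<U>\<^esub> (2::nat)"
    by (auto simp: \<beta>_def)
next
  assume "\<exists>\<beta>\<in>carrier (star_real \<U>). \<beta> \<noteq> \<zero>\<^bsub>star_real \<U>\<^esub> \<and> \<alpha> = \<beta> [^]\<^bsub>star_real \<U>\<^esub> (2::nat)"
  then obtain b where "\<alpha> = real_class \<U> (\<lambda>\<phi>. (b \<phi>)\<^sup>2)" "\<forall>\<^sub>F \<phi> in \<U>. b \<phi> \<noteq> 0"
    by (auto simp: carrier_star_real star_real_ops real_class_eq_iff real_class_power2 eventually_not_iff)
  then show "star_less \<U> \<zero>\<^bsub>star_real \<U>\<^esub> \<alpha>"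
    by (auto simp: star_real_ops star_less_real_class elim: eventually_mono)
qed

lemma char_zero_star_complex: "char_zero (star_complex \<U>)"
proof -
  have "[n] \<cdot>\<^bsub>star_complex \<U>\<^esub> \<one>\<^bsub>star_complex \<U>\<^esub> = star_class \<U> (\<lambda>_. of_nat n)" for n :: nat
    by (induction n) (simp_all add: star_complex_ops add.commute)
  then show ?thesis
    by (simp add: char_zero_def star_complex_ops star_class_eq_iff)
qed

lemma star_embed_hom: "star_embed \<U> \<in> ring_hom ring_of_type_algebra (star_complex \<U>)"
  by (intro ring_hom_memI) (simp_all add: ring_of_type_algebra_def star_embed_def star_complex_ops)

lemma real_embed_hom:
  "(\<lambda>r::real. star_embed \<U> (complex_of_real r)) \<in> ring_hom ring_of_type_algebra (star_real \<U>)"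
  by (intro ring_hom_memI) (simp_all add: ring_of_type_algebra_def star_embed_of_real star_real_ops
      del: of_real_mult of_real_add of_real_1)

lemma inj_star_embed: "inj (star_embed \<U>)"
  by (simp add: inj_def star_embed_def star_class_eq_iff)

text \<open>
  A sum of squares has a representative that is nonnegative at every index, whereas any real
  representative of \<open>- 1\<close> is negative almost everywhere.
\<close>

lemma formally_real_star_real: "formally_real (star_real \<U>)"
  unfolding formally_real_def
proof (intro conjI allI impI notI)
  fix n :: nat and f
  assume f: "f \<in> {..<n} \<rightarrow> carrier (star_real \<U>)"
    and eq: "(\<Oplus>\<^bsub>star_real \<U>\<^esub>i\<in>{..<n}. f i \<otimes>\<^bsub>star_real \<U>\<^esub> f i) = \<ominus>\<^bsub>star_real \<U>\<^esub> \<one>\<^bsub>star_real \<U>\<^esub>"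
  have "\<exists>a. (\<Oplus>\<^bsub>star_real \<U>\<^esub>i\<in>{..<m}. f i \<otimes>\<^bsub>star_real \<U>\<^esub> f i) = real_class \<U> a \<and> (\<forall>\<phi>. 0 \<le> a \<phi>)"
    if "m \<le> n" for m
    using that
  proof (induction m)
    case 0
    then show ?case
      by (auto simp: star_real_ops intro!: exI[of _ "\<lambda>_. 0"])
  next
    case (Suc m)
    then obtain a where a: "(\<Oplus>\<^bsub>star_real \<U>\<^esub>i\<in>{..<m}. f i \<otimes>\<^bsub>star_real \<U>\<^esub> f i) = real_class \<U> a" "\<And>\<phi>. 0 \<le> a \<phi>"
      by auto
    have "f m \<in> carrier (star_real \<U>)"
      using f Suc.prems by auto
    then obtain b where b: "f m = real_class \<U> b"
      by (auto simp: carrier_star_real)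
    have "(\<Oplus>\<^bsub>star_real \<U>\<^esub>i\<in>{..<Suc m}. f i \<otimes>\<^bsub>star_real \<U>\<^esub> f i)
        = f m \<otimes>\<^bsub>star_real \<U>\<^esub> f m \<oplus>\<^bsub>star_real \<U>\<^esub> (\<Oplus>\<^bsub>star_real \<U>\<^esub>i\<in>{..<m}. f i \<otimes>\<^bsub>star_real \<U>\<^esub> f i)"
      unfolding lessThan_Suc using f Suc.prems by (intro R.finsum_insert) auto
    also have "\<dots> = real_class \<U> (\<lambda>\<phi>. b \<phi> * b \<phi> + a \<phi>)"
      by (simp add: a(1) b star_real_ops)
    finally show ?case
      using a(2) by (intro exI[of _ "\<lambda>\<phi>. b \<phi> * b \<phi> + a \<phi>"]) simp
  qed
  from this[of n] obtain a where a: "\<ominus>\<^bsub>star_real \<U>\<^esub> \<one>\<^bsub>star_real \<U>\<^esub> = real_class \<U> a" "\<And>\<phi>. 0 \<le> a \<phi>"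
    using eq by auto
  have "real_class \<U> a \<oplus>\<^bsub>star_real \<U>\<^esub> \<one>\<^bsub>star_real \<U>\<^esub> = \<zero>\<^bsub>star_real \<U>\<^esub>"
    unfolding a(1)[symmetric] by (rule R.l_neg) simp
  then have "\<forall>\<^sub>F \<phi> in \<U>. a \<phi> + 1 = 0"
    by (simp add: star_real_ops real_class_eq_iff)
  moreover have "a \<phi> + 1 \<noteq> 0" for \<phi>
    using a(2)[of \<phi>] by linarith
  ultimately show False
    by simp
qed (rule field_star_real)

lemma algebraically_closed_star_complex: "algebraically_closed (star_complex \<U>)"
proof (rule algebraically_closed_quotient)
  show "family_hom (star_complex \<U>) (star_class \<U>)"
    by unfold_locales (simp_all add: star_complex_ops)
qed (simp_all add: field_star_complex carrier_star_complex)

text \<open>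
  Composing an embedding of the non-standard reals with the quotient map gives a homomorphism
  from the full power of \<open>\<real>\<close>, to which the general result on formally real fields applies.
\<close>

lemma real_closed_star_real: "real_closed_field TYPE('b) (star_real \<U>)"
  unfolding real_closed_field_def
proof (intro conjI allI impI)
  fix L :: "'b ring" and h
  assume "formally_real L \<and> h \<in> ring_hom (star_real \<U>) L \<and>
    (\<forall>x\<in>carrier L. (ring.algebraic L over (h ` carrier (star_real \<U>))) x)"
  then have L: "formally_real L" and h: "h \<in> ring_hom (star_real \<U>) L"
    and alg: "\<And>x. x \<in> carrier L \<Longrightarrow> (ring.algebraic L over (h ` carrier (star_real \<U>))) x"
    by blast+
  interpret L: field L
    using L by (simp add: formally_real_def)
  define g where "g a = h (real_class \<U> a)" for a
  have range_g: "range g = h ` carrier (star_real \<U>)"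
    by (auto simp: g_def carrier_star_real)
  have fam: "family_hom L g"
  proof
    show "g a \<in> carrier L" for a
      unfolding g_def by (rule ring_hom_closed[OF h real_class_closed])
    show "g (\<lambda>i. a i + b i) = g a \<oplus>\<^bsub>L\<^esub> g b" for a b
      unfolding g_def star_real_ops(2)[symmetric] by (rule ring_hom_add[OF h]) simp_all
    show "g (\<lambda>i. a i * b i) = g a \<otimes>\<^bsub>L\<^esub> g b" for a b
      unfolding g_def star_real_ops(1)[symmetric] by (rule ring_hom_mult[OF h]) simp_all
    show "g (\<lambda>_. 1) = \<one>\<^bsub>L\<^esub>"
      unfolding g_def star_real_ops(3)[symmetric] by (rule ring_hom_one[OF h])
  qed
  have sub: "subfield (range g) L"
    unfolding range_g by (rule subfield_image_hom[OF field_star_real L.field_axioms h])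
  have "x \<in> range g" if "x \<in> carrier L" for x
    using alg[OF that] unfolding range_g[symmetric]
    by (rule algebraic_over_real_families[OF L fam that _ subfieldE(1)[OF sub]])
  moreover have "range g \<subseteq> carrier L"
    unfolding range_g using ring_hom_closed[OF h] by auto
  ultimately show "h ` carrier (star_real \<U>) = carrier L"
    unfolding range_g by blast
qed (rule formally_real_star_real)

lemma cartesian_form_unique:
  "\<exists>!(\<alpha>, \<beta>). \<alpha> \<in> carrier (star_real \<U>) \<and> \<beta> \<in> carrier (star_real \<U>) \<and>
     star_class \<U> A = \<alpha> \<oplus>\<^bsub>star_complex \<U>\<^esub> \<beta> \<otimes>\<^bsub>star_complex \<U>\<^esub> star_embed \<U> \<i>"
proof (rule ex1I[of _ "(real_class \<U> (\<lambda>\<phi>. Re (A \<phi>)), real_class \<U> (\<lambda>\<phi>. Im (A \<phi>)))"])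
  show "case (real_class \<U> (\<lambda>\<phi>. Re (A \<phi>)), real_class \<U> (\<lambda>\<phi>. Im (A \<phi>))) of (\<alpha>, \<beta>) \<Rightarrow>
      \<alpha> \<in> carrier (star_real \<U>) \<and> \<beta> \<in> carrier (star_real \<U>) \<and>
      star_class \<U> A = \<alpha> \<oplus>\<^bsub>star_complex \<U>\<^esub> \<beta> \<otimes>\<^bsub>star_complex \<U>\<^esub> star_embed \<U> \<i>"
    by (simp add: cartesian_form)
next
  fix p
  assume p: "case p of (\<alpha>, \<beta>) \<Rightarrow> \<alpha> \<in> carrier (star_real \<U>) \<and> \<beta> \<in> carrier (star_real \<U>) \<and>
    star_class \<U> A = \<alpha> \<oplus>\<^bsub>star_complex \<U>\<^esub> \<beta> \<otimes>\<^bsub>star_complex \<U>\<^esub> star_embed \<U> \<i>"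
  then obtain a b where ab: "p = (real_class \<U> a, real_class \<U> b)"
    by (auto simp: carrier_star_real)
  with p have "\<forall>\<^sub>F \<phi> in \<U>. A \<phi> = Complex (a \<phi>) (b \<phi>)"
    by (simp add: cartesian_form star_class_eq_iff)
  then have "\<forall>\<^sub>F \<phi> in \<U>. a \<phi> = Re (A \<phi>)" "\<forall>\<^sub>F \<phi> in \<U>. b \<phi> = Im (A \<phi>)"
    by (auto elim: eventually_mono)
  then show "p = (real_class \<U> (\<lambda>\<phi>. Re (A \<phi>)), real_class \<U> (\<lambda>\<phi>. Im (A \<phi>)))"
    by (simp add: ab real_class_eq_iff)
qed

end

section \<open>Infinitesimals\<close>

text \<open>
  A function in all basic sets vanishes away from the origin, hence almost everywhere, and so
  cannot have integral \<open>1\<close>.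
\<close>

lemma no_test_function_in_all_basic_sets:
  "\<exists>n\<ge>1. \<phi> \<notin> basic_set n" for \<phi> :: "('n::finite) test_fun"
proof (rule ccontr)
  assume "\<not> (\<exists>n\<ge>1. \<phi> \<notin> basic_set n)"
  then have mem: "\<phi> \<in> basic_set n" if "n \<ge> 1" for n
    using that by auto
  have "apply_test \<phi> x = 0" if "x \<noteq> 0" for x
  proof -
    obtain n where n: "inverse (real (Suc n)) < norm x"
      using reals_Archimedean[of "norm x"] \<open>x \<noteq> 0\<close> by auto
    then show ?thesis
      using mem[of "Suc n"] by (simp add: basic_set_def inverse_eq_divide)
  qed
  then have "AE x in lborel. apply_test \<phi> x = 0"
    using AE_lborel_singleton[of 0] by (auto elim: eventually_mono)
  then have "(LINT x|lborel. apply_test \<phi> x) = 0"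
    by (rule integral_eq_zero_AE)
  then show False
    using mem[of 1] by (simp add: basic_set_def)
qed

text \<open>
  The first index \<open>N \<phi>\<close> at which \<open>\<phi>\<close> leaves the basic sets is finite, but exceeds each fixed \<open>n\<close>
  on the intersection of finitely many sets of the ultrafilter; so \<open>1 / N\<close> is infinitesimal.
\<close>

lemma (in star_construction) infinitesimal_exists:
  assumes "contains_basic_filter \<U>"
  shows "\<exists>a. (\<forall>\<phi>. 0 < a \<phi>) \<and> (\<forall>n::nat. n \<ge> 1 \<longrightarrow> (\<forall>\<^sub>F \<phi> in \<U>. a \<phi> < 1 / real n))"
proof -
  define N where "N \<phi> = (LEAST n. n \<ge> 1 \<and> \<phi> \<notin> basic_set n)" for \<phi> :: "'n test_fun"
  have N: "N \<phi> \<ge> 1 \<and> \<phi> \<notin> basic_set (N \<phi>)" for \<phi>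
    unfolding N_def using no_test_function_in_all_basic_sets[of \<phi>] by (rule LeastI_ex)
  have "\<forall>\<^sub>F \<phi> in \<U>. 1 / real (N \<phi>) < 1 / real n" if "n \<ge> 1" for n
  proof -
    have "\<forall>\<^sub>F \<phi> in \<U>. \<phi> \<in> basic_set k" if "k \<ge> 1" for k
      using assms that unfolding contains_basic_filter_def by blast
    then have "\<forall>\<^sub>F \<phi> in \<U>. \<forall>k\<in>{1..n}. \<phi> \<in> basic_set k"
      by (intro eventually_ball_finite) auto
    then show ?thesis
    proof eventually_elim
      case (elim \<phi>)
      then have "N \<phi> > n"
        using N[of \<phi>] by (metis atLeastAtMost_iff not_le)
      with that show ?case
        by (simp add: frac_less2)
    qed
  qed
  moreover have "0 < 1 / real (N \<phi>)" for \<phi>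
    using N[of \<phi>] by simp
  ultimately show ?thesis
    by (intro exI[of _ "\<lambda>\<phi>. 1 / real (N \<phi>)"]) blast
qed

context star_construction
begin

lemma non_archimedeanI:
  assumes "contains_basic_filter \<U>" and "carrier (star_real \<U>) \<subseteq> carrier K"
  shows "non_archimedean \<U> K"
proof -
  obtain a where pos: "\<And>\<phi>. 0 < a \<phi>" and small: "\<And>n::nat. n \<ge> 1 \<Longrightarrow> \<forall>\<^sub>F \<phi> in \<U>. a \<phi> < 1 / real n"
    using infinitesimal_exists[OF assms(1)] by blast
  have abs: "star_abs \<U> (real_class \<U> a) = real_class \<U> a"
    using pos by (simp add: real_class_def[of \<U> a] star_abs_star_class less_imp_le)
  have "star_embed \<U> 0 = real_class \<U> (\<lambda>_. 0)"
    and "star_embed \<U> (1 / of_nat n) = real_class \<U> (\<lambda>_. 1 / real n)" for n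
    using star_embed_of_real[of \<U> 0] star_embed_of_real[of \<U> "1 / real n"] by simp_all
  then show ?thesis
    unfolding non_archimedean_def using assms(2) pos small
    by (intro bexI[of _ "real_class \<U> a"]) (auto simp: abs star_less_real_class)
qed

lemma star_abs_eq_sqrt:
  "star_abs \<U> (star_class \<U> A) = star_sqrt \<U>
     (star_Re \<U> (star_class \<U> A) [^]\<^bsub>star_real \<U>\<^esub> (2::nat) \<oplus>\<^bsub>star_real \<U>\<^esub>
      star_Im \<U> (star_class \<U> A) [^]\<^bsub>star_real \<U>\<^esub> (2::nat))"
  by (simp add: star_abs_star_class star_Re_star_class star_Im_star_class real_class_power2
      star_real_ops star_sqrt_real_class cmod_def)

end

section \<open>The fields of non-standard numbers\<close>

theorem theorem5p1:
  fixes \<U> :: "('n::finite) test_fun filter"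
  assumes "ultrafilter \<U>"
    and "contains_basic_filter \<U>"
  shows
    "\<comment> \<open>(i)\<close>
     (\<forall>\<gamma>\<in>carrier (star_complex \<U>).
       (\<exists>!(\<alpha>, \<beta>). \<alpha> \<in> carrier (star_real \<U>) \<and> \<beta> \<in> carrier (star_real \<U>) \<and>
          \<gamma> = \<alpha> \<oplus>\<^bsub>star_complex \<U>\<^esub> \<beta> \<otimes>\<^bsub>star_complex \<U>\<^esub> star_embed \<U> \<i>) \<and>
       star_Re \<U> \<gamma> \<in> carrier (star_real \<U>) \<and> star_Im \<U> \<gamma> \<in> carrier (star_real \<U>) \<and>
       \<gamma> = star_Re \<U> \<gamma> \<oplus>\<^bsub>star_complex \<U>\<^esub> star_Im \<U> \<gamma> \<otimes>\<^bsub>star_complex \<U>\<^esub> star_embed \<U> \<i> \<and>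
       star_abs \<U> \<gamma> = star_sqrt \<U>
         (star_Re \<U> \<gamma> [^]\<^bsub>star_real \<U>\<^esub> (2::nat) \<oplus>\<^bsub>star_real \<U>\<^esub>
          star_Im \<U> \<gamma> [^]\<^bsub>star_real \<U>\<^esub> (2::nat))) \<and>
     \<comment> \<open>(ii)\<close>
     field (star_complex \<U>) \<and>
     algebraically_closed (star_complex \<U>) \<and>
     non_archimedean \<U> (star_complex \<U>) \<and>
     char_zero (star_complex \<U>) \<and>
     star_embed \<U> \<in> ring_hom ring_of_type_algebra (star_complex \<U>) \<and>
     inj (star_embed \<U>) \<and>
     subfield (range (star_embed \<U>)) (star_complex \<U>) \<and>
     \<comment> \<open>(iii)\<close>
     totally_ordered_field (star_real \<U>) (star_less \<U>) \<and>
     non_archimedean \<U> (star_real \<U>) \<and>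
     real_closed_field TYPE('b) (star_real \<U>) \<and>
     (\<forall>\<alpha>\<in>carrier (star_real \<U>).
       star_less \<U> \<zero>\<^bsub>star_real \<U>\<^esub> \<alpha> \<longleftrightarrow>
       (\<exists>\<beta>\<in>carrier (star_real \<U>). \<beta> \<noteq> \<zero>\<^bsub>star_real \<U>\<^esub> \<and> \<alpha> = \<beta> [^]\<^bsub>star_real \<U>\<^esub> (2::nat))) \<and>
     (\<lambda>r::real. star_embed \<U> (complex_of_real r)) \<in> ring_hom ring_of_type_algebra (star_real \<U>) \<and>
     inj (\<lambda>r::real. star_embed \<U> (complex_of_real r)) \<and>
     subfield (range (\<lambda>r::real. star_embed \<U> (complex_of_real r))) (star_real \<U>) \<and>
     (\<forall>r s :: real. r < s \<longleftrightarrow>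
       star_less \<U> (star_embed \<U> (complex_of_real r)) (star_embed \<U> (complex_of_real s)))"
proof (intro conjI ballI)
  interpret star_construction \<U>
    using assms(1) by unfold_locales
  fix \<gamma> assume "\<gamma> \<in> carrier (star_complex \<U>)"
  then obtain A where A: "\<gamma> = star_class \<U> A"
    by (auto simp: carrier_star_complex)
  show "\<exists>!(\<alpha>, \<beta>). \<alpha> \<in> carrier (star_real \<U>) \<and> \<beta> \<in> carrier (star_real \<U>) \<and>
      \<gamma> = \<alpha> \<oplus>\<^bsub>star_complex \<U>\<^esub> \<beta> \<otimes>\<^bsub>star_complex \<U>\<^esub> star_embed \<U> \<i>"
    unfolding A by (rule cartesian_form_unique)
  show "star_Re \<U> \<gamma> \<in> carrier (star_real \<U>)" and "star_Im \<U> \<gamma> \<in> carrier (star_real \<U>)"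
    by (simp_all add: A star_Re_star_class star_Im_star_class)
  show "\<gamma> = star_Re \<U> \<gamma> \<oplus>\<^bsub>star_complex \<U>\<^esub> star_Im \<U> \<gamma> \<otimes>\<^bsub>star_complex \<U>\<^esub> star_embed \<U> \<i>"
    by (simp add: A star_Re_star_class star_Im_star_class cartesian_form)
  show "star_abs \<U> \<gamma> = star_sqrt \<U>
      (star_Re \<U> \<gamma> [^]\<^bsub>star_real \<U>\<^esub> (2::nat) \<oplus>\<^bsub>star_real \<U>\<^esub>
       star_Im \<U> \<gamma> [^]\<^bsub>star_real \<U>\<^esub> (2::nat))"
    unfolding A by (rule star_abs_eq_sqrt)
next
  interpret star_construction \<U>
    using assms(1) by unfold_locales
  show "field (star_complex \<U>)" "algebraically_closed (star_complex \<U>)" "char_zero (star_complex \<U>)"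
    by (fact field_star_complex algebraically_closed_star_complex char_zero_star_complex)+
  show "non_archimedean \<U> (star_complex \<U>)" "non_archimedean \<U> (star_real \<U>)"
    using subfieldE(3)[OF subfield_star_real] by (auto intro: non_archimedeanI[OF assms(2)])
  show "star_embed \<U> \<in> ring_hom ring_of_type_algebra (star_complex \<U>)"
    and "(\<lambda>r::real. star_embed \<U> (complex_of_real r)) \<in> ring_hom ring_of_type_algebra (star_real \<U>)"
    by (fact star_embed_hom real_embed_hom)+
  show "inj (star_embed \<U>)"
    by (rule inj_star_embed)
  show "inj (\<lambda>r::real. star_embed \<U> (complex_of_real r))"
    by (simp add: inj_def star_embed_of_real real_class_eq_iff)
  show "subfield (range (star_embed \<U>)) (star_complex \<U>)"
    using subfield_image_hom[OF field_from_type_algebra field_star_complex star_embed_hom]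
    by (simp add: ring_of_type_algebra_def)
  show "subfield (range (\<lambda>r::real. star_embed \<U> (complex_of_real r))) (star_real \<U>)"
    using subfield_image_hom[OF field_from_type_algebra field_star_real real_embed_hom]
    by (simp add: ring_of_type_algebra_def)
  show "totally_ordered_field (star_real \<U>) (star_less \<U>)"
    by (rule totally_ordered_star_real)
  show "real_closed_field TYPE('b) (star_real \<U>)"
    by (rule real_closed_star_real)
  show "star_less \<U> \<zero>\<^bsub>star_real \<U>\<^esub> \<alpha> \<longleftrightarrow>
      (\<exists>\<beta>\<in>carrier (star_real \<U>). \<beta> \<noteq> \<zero>\<^bsub>star_real \<U>\<^esub> \<and> \<alpha> = \<beta> [^]\<^bsub>star_real \<U>\<^esub> (2::nat))"
    if "\<alpha> \<in> carrier (star_real \<U>)" for \<alpha>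
    using that by (rule pos_iff_nonzero_square)
  show "\<forall>r s :: real. r < s \<longleftrightarrow>
      star_less \<U> (star_embed \<U> (complex_of_real r)) (star_embed \<U> (complex_of_real s))"
    by (simp add: star_embed_of_real star_less_real_class)
qed

end
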